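(* Let $a \in A$ have degree $d \geqslant 0$. Then for $0 \leqslant k \leqslant d$, $$ \genfrac{\{}{\}}{0pt}{}{a}{k} = \sum_{j=k}^{d} \partial_{\theta}^j(a) \cdot h_{k,j-k}\bigl([1], \dots, [k]\bigr). $$
   Context: Let $q$ be a power of a prime and $A = \mathbb{F}_q[\theta]$. Let $A[\tau]$ be the ring of twisted polynomials, in which $\tau b = b^q\tau$ for $b \in A$. The Carlitz module is the $\mathbb{F}_q$-algebra homomorphism $C : A \to A[\tau]$, $a \mapsto C_a$, determined by $C_\theta = \theta + \tau$. For $a\in A$ the coefficients $\genfrac{\{}{\}}{0pt}{}{a}{k} \in A$ are defined by $C_a = \sum_{k=0}^{\deg a} \genfrac{\{}{\}}{0pt}{}{a}{k}\tau^k$. For $i\geqslant 0$, $[i] = \theta^{q^i}-\theta \in A$. For $j \geqslant 0$, the hyperderivative $\partial_\theta^j : A \to A$ is the $\mathbb{F}_q$-linear map with $\partial_\theta^j(\theta^n) = \binom{n}{j}\theta^{n-j}$ (which is $0$ when $n<j$). The symbol $h_{ij}=h_{i,j}$ denotes the complete homogeneous symmetric polynomial of degree $j$ in $i$ variables, defined by $\sum_{j\geqslant 0} h_{ij}(x_1,\dots,x_i)t^j = \prod_{r=1}^i (1-x_rt)^{-1}$; in particular $h_{0,0}=1$ and $h_{0,j}=0$ for $j>0$. *)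

theory Defs
  imports "HOL-Computational_Algebra.Computational_Algebra" "HOL-Library.Cardinality"
begin

(* Throughout, F_q is the type 'a :: finite_field with q = CARD('a), and A = F_q[theta] is
   'a poly, the polynomial variable playing the role of theta. *)

abbreviation theta :: "'a :: comm_semiring_1 poly"
  where "theta \<equiv> [:0, 1:]"

lemma binomial_CARD_eq_0:
  assumes k: "0 < k" "k < CARD('a)"
  shows "of_nat (CARD('a) choose k) = (0 :: 'a :: finite_field)"
proof -
  define q where "q = CARD('a)"
  define p :: "'a poly" where
    "p = (\<Sum>i\<in>{0<..<q}. monom (of_nat (q choose i)) i)"
  have q: "q > 0" unfolding q_def by (simp add: finite_UNIV_card_ge_0)
  have root: "poly p x = 0" for x
  proof -
    have split: "{..q} = insert 0 (insert q {0<..<q})" using q by auto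
    have "(x + 1) ^ q = (\<Sum>i\<le>q. of_nat (q choose i) * x ^ i)"
      by (simp add: binomial_ring)
    also have "\<dots> = 1 + x ^ q + poly p x"
      using q unfolding split p_def by (simp add: poly_sum poly_monom)
    finally show ?thesis
      using finite_field_power_card_eq_same[of x] finite_field_power_card_eq_same[of "x + 1"]
      unfolding q_def by simp
  qed
  have "p = 0"
  proof (rule ccontr)
    assume nz: "p \<noteq> 0"
    have "card {x. poly p x = 0} \<le> degree p"
      by (rule card_poly_roots_bound[OF nz])
    also have "{x. poly p x = 0} = UNIV" using root by auto
    finally have le: "q \<le> degree p" unfolding q_def .
    have "degree p \<le> q - 1"
      unfolding p_def by (rule degree_sum_le) (auto intro: order.trans[OF degree_monom_le])
    with le q show False by simp
  qed
  moreover have "coeff p k = of_nat (q choose k)"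
    using k unfolding p_def q_def by (simp add: coeff_sum)
  ultimately show ?thesis by (simp add: q_def)
qed

lemma frob_add: "(x + y) ^ CARD('a) = x ^ CARD('a) + (y :: 'a :: finite_field poly) ^ CARD('a)"
proof -
  define q where "q = CARD('a)"
  have q: "q > 0" unfolding q_def by (simp add: finite_UNIV_card_ge_0)
  have split: "{..q} = insert 0 (insert q {0<..<q})" using q by auto
  have "(x + y) ^ q = (\<Sum>i\<le>q. of_nat (q choose i) * x ^ i * y ^ (q - i))"
    by (simp add: binomial_ring)
  also have "\<dots> = x ^ q + y ^ q + (\<Sum>i\<in>{0<..<q}. of_nat (q choose i) * x ^ i * y ^ (q - i))"
    using q unfolding split by simp
  also have "(\<Sum>i\<in>{0<..<q}. of_nat (q choose i) * x ^ i * y ^ (q - i)) = 0"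
    by (rule sum.neutral) (auto simp: q_def of_nat_poly binomial_CARD_eq_0)
  finally show ?thesis by (simp add: q_def)
qed

lemma frob_pow_add:
  "(x + y) ^ (CARD('a) ^ n) = x ^ (CARD('a) ^ n) + (y :: 'a :: finite_field poly) ^ (CARD('a) ^ n)"
  by (induction n) (simp_all add: power_mult mult.commute[of "CARD('a)"] frob_add)

lemma frob_pow_sum:
  "(\<Sum>i\<in>I. f i) ^ (CARD('a) ^ n) = (\<Sum>i\<in>I. (f i :: 'a :: finite_field poly) ^ (CARD('a) ^ n))"
  by (induction I rule: infinite_finite_induct)
     (simp_all add: frob_pow_add power_0_left finite_UNIV_card_ge_0)

lemma frob_pow_0: "(0 :: 'a :: finite_field poly) ^ (CARD('a) ^ n) = 0"
  by (simp add: power_0_left)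

lemma frob_pow_minus:
  "(- x) ^ (CARD('a) ^ n) = - ((x :: 'a :: finite_field poly) ^ (CARD('a) ^ n))"
  using frob_pow_add[of x "- x" n] by (simp add: frob_pow_0 add_eq_0_iff)

lemma frob_pow_const: "[:c:] ^ (CARD('a) ^ n) = [:c :: 'a :: finite_field:]"
  by (simp add: poly_const_pow finite_field_power_card_power_eq_same)


text \<open>
  The ring \<open>A[\<tau>]\<close>: an element \<open>\<Sum>\<^sub>n b\<^sub>n \<tau>\<^sup>n\<close> is represented by its finitely supported
  sequence of (left) coefficients \<open>b\<^sub>n \<in> A\<close>.
\<close>

typedef (overloaded) 'a twpoly = "{f :: nat \<Rightarrow> 'a :: finite_field poly. \<forall>\<^sub>\<infinity>n. f n = 0}"
  morphisms twcoeff Abs_twpoly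
  by (rule exI[of _ "\<lambda>_. 0"]) simp

setup_lifting type_definition_twpoly

lemma twpoly_eqI: "(\<And>n. twcoeff f n = twcoeff g n) \<Longrightarrow> f = g"
  by (metis twcoeff_inject ext)

instantiation twpoly :: (finite_field) ring_1
begin

lift_definition zero_twpoly :: "'a twpoly" is "\<lambda>_. 0" by simp

lift_definition one_twpoly :: "'a twpoly" is "\<lambda>n. if n = 0 then 1 else 0"
  by (auto simp: MOST_nat)

lift_definition plus_twpoly :: "'a twpoly \<Rightarrow> 'a twpoly \<Rightarrow> 'a twpoly"
  is "\<lambda>f g n. f n + g n"
  by (erule (1) eventually_elim2) simp

lift_definition minus_twpoly :: "'a twpoly \<Rightarrow> 'a twpoly \<Rightarrow> 'a twpoly"
  is "\<lambda>f g n. f n - g n"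
  by (erule (1) eventually_elim2) simp

lift_definition uminus_twpoly :: "'a twpoly \<Rightarrow> 'a twpoly"
  is "\<lambda>f n. - f n"
  by simp

(* (b tau^i) (c tau^j) = b c^(q^i) tau^(i+j) *)
lift_definition times_twpoly :: "'a twpoly \<Rightarrow> 'a twpoly \<Rightarrow> 'a twpoly"
  is "\<lambda>f g n. \<Sum>i\<le>n. f i * g (n - i) ^ (CARD('a) ^ i)"
proof -
  fix f g :: "nat \<Rightarrow> 'a poly"
  assume "\<forall>\<^sub>\<infinity>n. f n = 0" "\<forall>\<^sub>\<infinity>n. g n = 0"
  then obtain M N where M: "\<And>n. n > M \<Longrightarrow> f n = 0" and N: "\<And>n. n > N \<Longrightarrow> g n = 0"
    by (auto simp: MOST_nat)
  have "f i * g (n - i) ^ (CARD('a) ^ i) = 0" if "n > M + N" for i n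
  proof (cases "i > M")
    case False
    then have "n - i > N" using that by simp
    then show ?thesis using N by (simp add: frob_pow_0)
  qed (use M in simp)
  then show "\<forall>\<^sub>\<infinity>n. (\<Sum>i\<le>n. f i * g (n - i) ^ (CARD('a) ^ i)) = 0"
    unfolding MOST_nat by (intro exI[of _ "M + N"] allI impI sum.neutral) auto
qed

instance
proof
  fix f g h :: "'a twpoly"
  show "f + g + h = f + (g + h)" "f + g = g + f" "0 + f = f" "- f + f = 0" "f - g = f + - g"
    by (transfer; simp add: algebra_simps fun_eq_iff)+
  show "(0 :: 'a twpoly) \<noteq> 1"
    by transfer (auto simp: fun_eq_iff)
  show "1 * f = f"
    by transfer (auto simp: fun_eq_iff if_distrib[of "\<lambda>x. x * _"] sum.delta cong: if_cong)
  show "f * 1 = f"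
  proof (rule twpoly_eqI)
    fix n
    have "twcoeff (f * 1) n = (\<Sum>i\<le>n. if i = n then twcoeff f i else 0)"
      unfolding times_twpoly.rep_eq one_twpoly.rep_eq
      by (intro sum.cong) (auto simp: frob_pow_0)
    then show "twcoeff (f * 1) n = twcoeff f n" by simp
  qed
  show "(f + g) * h = f * h + g * h"
    by transfer (simp add: fun_eq_iff algebra_simps sum.distrib)
  show "f * (g + h) = f * g + f * h"
    by transfer (simp add: fun_eq_iff frob_pow_add distrib_left sum.distrib)
  show "f * g * h = f * (g * h)"
  proof (rule twpoly_eqI)
    fix n
    let ?q = "CARD('a)"
    have "twcoeff (f * g * h) n =
        (\<Sum>i=0..n. \<Sum>j=0..i. twcoeff f j * twcoeff g (i - j) ^ (?q ^ j)
             * twcoeff h (n - i) ^ (?q ^ (j + (i - j))))"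
      unfolding times_twpoly.rep_eq atMost_atLeast0 sum_distrib_right
      by (intro sum.cong refl) simp
    also have "\<dots> = (\<Sum>j=0..n. \<Sum>i=0..n-j. twcoeff f j * twcoeff g i ^ (?q ^ j)
             * twcoeff h (n - j - i) ^ (?q ^ (j + i)))"
      using fps_mult_assoc_lemma[where k = n and f = "\<lambda>j i m. twcoeff f j * twcoeff g i ^ (?q ^ j)
             * twcoeff h m ^ (?q ^ (j + i))"] by simp
    also have "\<dots> = twcoeff (f * (g * h)) n"
      unfolding times_twpoly.rep_eq atMost_atLeast0 frob_pow_sum sum_distrib_left
      by (intro sum.cong refl)
         (simp add: power_mult_distrib power_add mult.assoc mult.commute flip: power_mult)
    finally show "twcoeff (f * g * h) n = twcoeff (f * (g * h)) n" .
  qed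
qed

end

definition twconst :: "'a :: finite_field poly \<Rightarrow> 'a twpoly"
  where "twconst b = Abs_twpoly (\<lambda>n. if n = 0 then b else 0)"

lemma twcoeff_twconst: "twcoeff (twconst b) n = (if n = 0 then b else 0)"
  by (auto simp: twconst_def Abs_twpoly_inverse MOST_nat)

lift_definition tau :: "'a :: finite_field twpoly" is "\<lambda>n. if n = 1 then 1 else 0"
  by (auto simp: MOST_nat)

lift_definition twsmult :: "'a :: finite_field \<Rightarrow> 'a twpoly \<Rightarrow> 'a twpoly"
  is "\<lambda>c f n. smult c (f n)"
  by (auto elim: MOST_rev_mp)

lemma twconst_mult_coeff: "twcoeff (twconst b * f) n = b * twcoeff f n"
proof -
  have "twcoeff (twconst b * f) n = (\<Sum>i\<le>n. if i = 0 then b * twcoeff f n else 0)"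
    unfolding times_twpoly.rep_eq twcoeff_twconst by (intro sum.cong) auto
  then show ?thesis by simp
qed

lemma mult_twconst_coeff:
  "twcoeff (f * twconst b) n = twcoeff f n * (b :: 'a :: finite_field poly) ^ (CARD('a) ^ n)"
proof -
  have "twcoeff (f * twconst b) n =
      (\<Sum>i\<le>n. if i = n then twcoeff f n * b ^ (CARD('a) ^ n) else 0)"
    unfolding times_twpoly.rep_eq twcoeff_twconst by (intro sum.cong) (auto simp: frob_pow_0)
  then show ?thesis by simp
qed

lemma tau_commute:
  "tau * twconst b = twconst ((b :: 'a :: finite_field poly) ^ CARD('a)) * tau"
  by (rule twpoly_eqI) (auto simp: mult_twconst_coeff twconst_mult_coeff tau.rep_eq)

lemma twconst_hom:
  "twconst 1 = 1" "twconst (b + c) = twconst b + twconst c" "twconst (b * c) = twconst b * twconst c"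
  by (rule twpoly_eqI; simp add: one_twpoly.rep_eq plus_twpoly.rep_eq twconst_mult_coeff
        twcoeff_twconst)+

lemma twsmult_conv: "twsmult c f = twconst [:c:] * f"
  by (rule twpoly_eqI) (simp add: twconst_mult_coeff twsmult.rep_eq)

lemma twsmult_central: "f * twconst [:c:] = twconst [:c:] * f"
  by (rule twpoly_eqI)
     (simp add: twconst_mult_coeff mult_twconst_coeff frob_pow_const mult.commute)

lemma tau_power_coeff: "twcoeff (tau ^ n) k = (if k = n then 1 else 0)"
proof (induction n arbitrary: k)
  case (Suc n)
  have "twcoeff (tau ^ Suc n) k =
      (\<Sum>i\<le>k. if i = 1 then (if k - 1 = n then 1 else 0) else (0 :: 'a poly))"
    unfolding power_Suc times_twpoly.rep_eq tau.rep_eq Suc.IH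
    by (intro sum.cong) (auto simp: power_0_left)
  then show ?case by auto
qed (simp add: one_twpoly.rep_eq)

lemma twcoeff_sum: "twcoeff (\<Sum>i\<in>I. f i) n = (\<Sum>i\<in>I. twcoeff (f i) n)"
  by (induction I rule: infinite_finite_induct)
     (simp_all add: zero_twpoly.rep_eq plus_twpoly.rep_eq)

lemma twpoly_expansion:
  assumes "\<And>n. n > N \<Longrightarrow> twcoeff f n = 0"
  shows "f = (\<Sum>n\<le>N. twconst (twcoeff f n) * tau ^ n)"
proof (rule twpoly_eqI)
  fix k
  have "twcoeff (\<Sum>n\<le>N. twconst (twcoeff f n) * tau ^ n) k =
      (\<Sum>n\<le>N. if n = k then twcoeff f k else 0)"
    unfolding twcoeff_sum by (intro sum.cong) (auto simp: twconst_mult_coeff tau_power_coeff)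
  then show "twcoeff f k = twcoeff (\<Sum>n\<le>N. twconst (twcoeff f n) * tau ^ n) k"
    using assms[of k] by auto
qed


definition Fq_algebra_hom :: "('a :: finite_field poly \<Rightarrow> 'a twpoly) \<Rightarrow> bool"
  where "Fq_algebra_hom C \<longleftrightarrow>
    C 1 = 1 \<and> (\<forall>a b. C (a + b) = C a + C b) \<and> (\<forall>a b. C (a * b) = C a * C b) \<and>
    (\<forall>c a. C (smult c a) = twsmult c (C a))"

(* Well defined by the lemma carlitz_ex1 below. *)
definition carlitz :: "'a :: finite_field poly \<Rightarrow> 'a twpoly"
  where "carlitz = (THE C. Fq_algebra_hom C \<and> C theta = twconst theta + tau)"

lemma carlitz_ex1:
  "\<exists>!C :: 'a :: finite_field poly \<Rightarrow> 'a twpoly.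
     Fq_algebra_hom C \<and> C theta = twconst theta + tau"
proof (rule ex_ex1I)
  define T :: "'a twpoly" where "T = twconst theta + tau"
  define C where "C = (\<lambda>a :: 'a poly. fold_coeffs (\<lambda>c r. twconst [:c:] + T * r) a 0)"
  have twconst_0: "twconst 0 = (0 :: 'a twpoly)"
    by (rule twpoly_eqI) (simp add: twcoeff_twconst zero_twpoly.rep_eq)
  have C_0: "C 0 = 0" by (simp add: C_def)
  have C_pCons: "C (pCons c p) = twconst [:c:] + T * C p" for c p
    by (cases "p = 0"; cases "c = 0") (simp_all add: C_def twconst_0)
  have C_add: "C (a + b) = C a + C b" for a b
  proof (induction a b rule: poly_induct2)
    case (pCons c p d r)
    have "twconst [:c + d:] = twconst [:c:] + twconst [:d:]"
      using twconst_hom(2)[of "[:c:]" "[:d:]"] by simp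
    with pCons show ?case by (simp add: C_pCons algebra_simps)
  qed (simp add: C_0)
  have C_smult: "C (smult c a) = twconst [:c:] * C a" for c a
  proof (induction a)
    case (pCons d p)
    have "twconst [:c * d:] = twconst [:c:] * twconst [:d:]"
      using twconst_hom(3)[of "[:c:]" "[:d:]"] by (simp add: mult.commute)
    moreover have "T * (twconst [:c:] * C p) = twconst [:c:] * (T * C p)"
      by (metis mult.assoc twsmult_central)
    ultimately show ?case by (simp add: C_pCons pCons.IH distrib_left mult.assoc)
  qed (simp add: C_0)
  have C_mult: "C (a * b) = C a * C b" for a b
  proof (induction a)
    case (pCons c p)
    have "C (pCons 0 (p * b)) = T * C (p * b)" by (simp add: C_pCons twconst_0)
    then show ?case
      by (simp add: C_add C_smult C_pCons pCons.IH distrib_right mult.assoc)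
  qed (simp add: C_0)
  have C_1: "C 1 = 1"
    by (simp add: one_pCons C_pCons C_0) (simp add: twconst_hom flip: one_pCons)
  have "C theta = T"
    by (simp add: C_pCons C_0 twconst_0) (simp add: twconst_hom flip: one_pCons)
  with C_1 C_add C_mult C_smult
  show "\<exists>C. Fq_algebra_hom C \<and> C theta = twconst theta + (tau :: 'a twpoly)"
    unfolding Fq_algebra_hom_def T_def twsmult_conv by blast
next
  fix C D :: "'a poly \<Rightarrow> 'a twpoly"
  assume C: "Fq_algebra_hom C \<and> C theta = twconst theta + tau"
  assume D: "Fq_algebra_hom D \<and> D theta = twconst theta + tau"
  have rec: "E (pCons c p) = twsmult c 1 + (twconst theta + tau) * E p"
    if "Fq_algebra_hom E \<and> E theta = twconst theta + tau" for E :: "'a poly \<Rightarrow> 'a twpoly" and c p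
  proof -
    have "pCons c p = smult c 1 + theta * p" by simp
    then show ?thesis using that unfolding Fq_algebra_hom_def by metis
  qed
  have zero: "E 0 = 0" if "Fq_algebra_hom E" for E :: "'a poly \<Rightarrow> 'a twpoly"
    using that unfolding Fq_algebra_hom_def by (metis add_cancel_right_left)
  show "C = D"
  proof
    fix a show "C a = D a"
      by (induction a) (simp_all only: rec[OF C] rec[OF D] zero[OF conjunct1[OF C]]
        zero[OF conjunct1[OF D]])
  qed
qed

lemma carlitz: "Fq_algebra_hom carlitz" "carlitz theta = twconst theta + tau"
  using theI'[OF carlitz_ex1] unfolding carlitz_def by blast+


definition carlitz_coeff :: "'a :: finite_field poly \<Rightarrow> nat \<Rightarrow> 'a poly"
  where "carlitz_coeff a k = twcoeff (carlitz a) k"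

lemma carlitz_0: "carlitz 0 = 0"
  using carlitz(1) unfolding Fq_algebra_hom_def by (metis add_cancel_right_left)

lemma carlitz_pCons:
  "carlitz (pCons c p) = twconst [:c:] + (twconst theta + tau) * carlitz p"
proof -
  have "pCons c p = smult c 1 + theta * p" by simp
  then have "carlitz (pCons c p) = twsmult c 1 + (twconst theta + tau) * carlitz p"
    using carlitz unfolding Fq_algebra_hom_def by metis
  then show ?thesis by (simp add: twsmult_conv)
qed

lemma carlitz_coeff_eq_0: "k > degree a \<Longrightarrow> carlitz_coeff a k = 0"
proof (induction a arbitrary: k)
  case (pCons c p)
  have tau: "twcoeff (tau * f) k = (if k = 0 then 0 else twcoeff f (k - 1) ^ CARD('a))"
    for f :: "'a twpoly"
  proof -
    have "twcoeff (tau * f) k =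
        (\<Sum>i\<le>k. if i = 1 then twcoeff f (k - 1) ^ CARD('a) else 0)"
      unfolding times_twpoly.rep_eq tau.rep_eq by (intro sum.cong) auto
    then show ?thesis by auto
  qed
  from pCons.prems have k: "k > 0" by simp
  have "twcoeff (carlitz p) k = 0 \<and> twcoeff (carlitz p) (k - 1) = 0"
  proof (cases "p = 0")
    case False
    with pCons.prems have "k > degree p" "k - 1 > degree p" by auto
    then show ?thesis using pCons.IH by (simp add: carlitz_coeff_def)
  qed (simp add: carlitz_0 zero_twpoly.rep_eq)
  with k show ?case
    by (simp add: carlitz_coeff_def carlitz_pCons distrib_right plus_twpoly.rep_eq
        twcoeff_twconst twconst_mult_coeff tau power_0_left)
qed (simp add: carlitz_coeff_def carlitz_0 zero_twpoly.rep_eq)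

lemma carlitz_expansion:
  "carlitz a = (\<Sum>k\<le>degree a. twconst (carlitz_coeff a k) * tau ^ k)"
  unfolding carlitz_coeff_def
  by (rule twpoly_expansion) (simp add: carlitz_coeff_eq_0 flip: carlitz_coeff_def)

definition carlitz_bracket :: "nat \<Rightarrow> 'a :: finite_field poly"
  where "carlitz_bracket i = theta ^ (CARD('a) ^ i) - theta"

(* The linear extension of theta^n |-> (n choose j) theta^(n-j); for n < j the binomial
   coefficient vanishes, so the truncated exponent is harmless. *)
definition hyperderiv :: "nat \<Rightarrow> 'a :: comm_ring_1 poly \<Rightarrow> 'a poly"
  where "hyperderiv j a =
    (\<Sum>n\<le>degree a. smult (coeff a n) (of_nat (n choose j) * theta ^ (n - j)))"

lemma coeff_hyperderiv: "coeff (hyperderiv j a) m = of_nat ((m + j) choose j) * coeff a (m + j)"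
proof -
  have 1: "smult c (of_nat b * theta ^ m) = monom (c * of_nat b) m" for c :: 'a and b m
    by (simp add: of_nat_poly smult_monom flip: monom_altdef)
  have "coeff (hyperderiv j a) m =
      (\<Sum>n\<le>degree a. if n = m + j then coeff a n * of_nat (n choose j) else 0)"
    unfolding hyperderiv_def coeff_sum 1
    by (intro sum.cong) (auto simp: binomial_eq_0 not_le)
  also have "\<dots> = of_nat ((m + j) choose j) * coeff a (m + j)"
    by (auto simp: coeff_eq_0 mult.commute)
  finally show ?thesis .
qed

lemma hyperderiv_linear:
  "hyperderiv j (a + b) = hyperderiv j a + hyperderiv j b"
  "hyperderiv j (smult c a) = smult c (hyperderiv j a)"
  by (auto simp: poly_eq_iff coeff_hyperderiv algebra_simps)

lemma hyperderiv_theta_power: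
  "hyperderiv j (theta ^ n) = of_nat (n choose j) * (theta :: 'a :: comm_ring_1 poly) ^ (n - j)"
proof -
  have "coeff (theta ^ l) m = (if m = l then 1 else 0 :: 'a)" for l m
    by (simp flip: monom_altdef[of 1, simplified])
  then show ?thesis
    by (auto simp: poly_eq_iff coeff_hyperderiv of_nat_poly binomial_eq_0 not_le)
qed

(* h_{i,j}(x_1,...,x_i): the coefficient of t^j in prod_{r=1..i} (1 - x_r t)^(-1), taken in the
   ring of power series over a commutative ring; see complete_homogeneous_gf. *)
definition complete_homogeneous :: "nat \<Rightarrow> nat \<Rightarrow> (nat \<Rightarrow> 'a :: comm_ring_1) \<Rightarrow> 'a"
  where "complete_homogeneous i j x =
    fps_nth (\<Prod>r=1..i. fps_right_inverse (1 - fps_const (x r) * fps_X) 1) j"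

lemma complete_homogeneous_gf:
  "Abs_fps (\<lambda>j. complete_homogeneous i j x) * (\<Prod>r=1..i. 1 - fps_const (x r) * fps_X) = 1"
proof -
  have "(1 - fps_const c * fps_X) * fps_right_inverse (1 - fps_const c * fps_X) 1 = 1" for c :: 'a
    by (rule fps_right_inverse) simp
  moreover have "Abs_fps (\<lambda>j. complete_homogeneous i j x) =
      (\<Prod>r=1..i. fps_right_inverse (1 - fps_const (x r) * fps_X) 1)"
    by (simp add: fps_eq_iff complete_homogeneous_def)
  ultimately show ?thesis
    by (subst mult.commute) (simp only: prod.distrib[symmetric] prod.neutral_const)
qed

end

theory Submission
  imports Defs
begin

text \<open>
  On \<open>A[\<tau>]\<close> let \<open>L\<close> be left multiplication by \<open>\<theta>\<close> and \<open>R\<close> right multiplication by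
  \<open>C\<^sub>\<theta> = \<theta> + \<tau>\<close>.  These two operators commute, and \<open>C\<^sub>a = a(R) 1\<close>.  Taylor expansion of
  \<open>a(R) = a(L + (R - L))\<close> around \<open>L\<close>, with the hyperderivatives as Taylor coefficients, gives
  \<open>C\<^sub>a = \<Sum>\<^sub>j \<partial>\<^sup>j(a) \<cdot> (R - L)\<^sup>j 1\<close>.
  Since \<open>\<tau>\<^sup>k \<theta> = \<theta>\<^bsup>q^k\<^esup> \<tau>\<^sup>k\<close>, the difference acts by \<open>(R - L) \<tau>\<^sup>k = [k] \<tau>\<^sup>k + \<tau>\<^bsup>k+1\<^esup>\<close>.
  Reaching \<open>\<tau>\<^sup>k\<close> from \<open>1\<close> in \<open>j\<close> steps therefore takes \<open>k\<close> raising steps and \<open>j - k\<close> waiting steps,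
  a wait at level \<open>r\<close> costing a factor \<open>[r]\<close>; as \<open>[0] = 0\<close>, the coefficient of \<open>\<tau>\<^sup>k\<close> in
  \<open>(R - L)\<^sup>j 1\<close> is \<open>h\<^bsub>k,j-k\<^esub>([1], \<dots>, [k])\<close>.

  In the formal proof the operators are replaced by the recursions that they induce on
  coefficients: \<open>carlitz_coeff_theta_mult\<close> is the action of \<open>R\<close>, \<open>hyperderiv_Suc_theta_mult\<close> is
  the Leibniz rule behind the Taylor expansion, and \<open>difference_coeff_Suc\<close> is the action of
  \<open>R - L\<close>.
\<close>

lemma complete_homogeneous_0_left:
  "complete_homogeneous 0 m x = (if m = 0 then 1 else 0)"
  by (simp add: complete_homogeneous_def)

text \<open>
  Both recursions compare coefficients after clearing the last factor of the generating
  function: \<open>(1 - x\<^bsub>i+1\<^esub> t) \<Sum>\<^sub>m h\<^bsub>i+1,m\<^esub> t\<^sup>m = \<Sum>\<^sub>m h\<^bsub>i,m\<^esub> t\<^sup>m\<close>.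
\<close>

lemma complete_homogeneous_Suc_left:
  "complete_homogeneous (Suc i) 0 x = complete_homogeneous i 0 x"
  "complete_homogeneous (Suc i) (Suc m) x =
     complete_homogeneous i (Suc m) x + x (Suc i) * complete_homogeneous (Suc i) m x"
proof -
  define P where "P i = (\<Prod>r=1..i. fps_right_inverse (1 - fps_const (x r) * fps_X) 1)" for i
  define F where "F = 1 - fps_const (x (Suc i)) * fps_X"
  have "F * fps_right_inverse F 1 = 1"
    by (rule fps_right_inverse) (simp add: F_def)
  moreover have "F * P (Suc i) = P i * (F * fps_right_inverse F 1)"
    by (simp add: P_def F_def mult.left_commute)
  ultimately have "F * P (Suc i) = P i" by simp
  then have P: "P (Suc i) = P i + fps_const (x (Suc i)) * (fps_X * P (Suc i))"
    by (simp add: F_def algebra_simps)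
  have h: "complete_homogeneous l m x = fps_nth (P l) m" for l m
    by (simp add: complete_homogeneous_def P_def)
  show "complete_homogeneous (Suc i) 0 x = complete_homogeneous i 0 x"
    using arg_cong[OF P, of "\<lambda>f. fps_nth f 0"] by (simp add: h)
  show "complete_homogeneous (Suc i) (Suc m) x =
     complete_homogeneous i (Suc m) x + x (Suc i) * complete_homogeneous (Suc i) m x"
    using arg_cong[OF P, of "\<lambda>f. fps_nth f (Suc m)"] by (simp add: h)
qed

lemma complete_homogeneous_0_right: "complete_homogeneous i 0 x = 1"
  by (induction i) (simp_all add: complete_homogeneous_0_left complete_homogeneous_Suc_left)

text \<open>
  The coefficient of \<open>\<tau>\<^sup>k\<close> in \<open>(R - L)\<^sup>j 1\<close>.  The value is zero for
  \<open>j < k\<close> because each step raises the degree in \<open>\<tau>\<close> by at most one.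
\<close>

definition difference_coeff :: "nat \<Rightarrow> nat \<Rightarrow> 'a :: finite_field poly"
  where "difference_coeff k j =
    (if j < k then 0 else complete_homogeneous k (j - k) carlitz_bracket)"

lemma difference_coeff_0: "difference_coeff k 0 = (if k = 0 then 1 else 0)"
  by (simp add: difference_coeff_def complete_homogeneous_0_left)

lemma difference_coeff_Suc:
  "difference_coeff k (Suc j) =
     carlitz_bracket k * difference_coeff k j +
     (if k = 0 then 0 else difference_coeff (k - 1) j)"
proof (cases k)
  case 0
  then show ?thesis
    by (simp add: difference_coeff_def complete_homogeneous_0_left carlitz_bracket_def)
next
  case (Suc i)
  consider "j < i" | "j = i" | m where "j = Suc (i + m)"
    by (metis less_imp_Suc_add linorder_neqE_nat)
  then show ?thesis
  proof cases
    case 3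
    then have "Suc j - k = Suc m" "j - k = m" "j - i = Suc m"
      using Suc by simp_all
    then show ?thesis
      using Suc 3 by (simp add: difference_coeff_def complete_homogeneous_Suc_left)
  qed (use Suc in \<open>simp_all add: difference_coeff_def complete_homogeneous_0_right\<close>)
qed

lemma hyperderiv_0: "hyperderiv 0 a = a"
  by (simp add: poly_eq_iff coeff_hyperderiv)

lemma hyperderiv_Suc_const: "hyperderiv (Suc j) [:c:] = 0"
  by (simp add: poly_eq_iff coeff_hyperderiv)

text \<open>The Leibniz rule for hyperderivatives; on coefficients it is Pascal's rule.\<close>

lemma hyperderiv_Suc_theta_mult:
  "hyperderiv (Suc j) (theta * a) = theta * hyperderiv (Suc j) a + hyperderiv j a"
  by (auto simp: poly_eq_iff coeff_hyperderiv coeff_pCons algebra_simps binomial_eq_0 split: nat.splits)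

lemma hyperderiv_eq_0:
  assumes "\<And>n. n \<ge> j \<Longrightarrow> coeff a n = 0"
  shows "hyperderiv j a = 0"
  by (simp add: poly_eq_iff coeff_hyperderiv assms)

lemma twcoeff_mult_tau:
  "twcoeff (f * tau) k = (if k = 0 then 0 else twcoeff f (k - 1))"
proof -
  have "twcoeff (f * tau) k =
      (\<Sum>i\<le>k. if i = k - 1 \<and> 0 < k then twcoeff f i else 0)"
    unfolding times_twpoly.rep_eq tau.rep_eq
    by (intro sum.cong) (auto simp: power_0_left)
  then show ?thesis by (cases k) auto
qed

text \<open>
  Writing \<open>C\<^bsub>\<theta>a\<^esub> = C\<^sub>a C\<^sub>\<theta>\<close>, with \<open>C\<^sub>\<theta>\<close> on the right, keeps the recursion \<open>A\<close>-linear in the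
  coefficients of \<open>C\<^sub>a\<close>; the factorization \<open>C\<^sub>\<theta> C\<^sub>a\<close> would raise them to the \<open>q\<close>-th power.
\<close>

lemma carlitz_coeff_theta_mult:
  fixes a :: "'a :: finite_field poly"
  shows "carlitz_coeff (theta * a) k =
    carlitz_coeff a k * theta ^ (CARD('a) ^ k) +
    (if k = 0 then 0 else carlitz_coeff a (k - 1))"
proof -
  have "carlitz (theta * a) = carlitz (a * theta)"
    by (simp only: mult.commute)
  also have "\<dots> = carlitz a * (twconst theta + tau)"
    using carlitz unfolding Fq_algebra_hom_def by metis
  finally show ?thesis
    by (simp add: carlitz_coeff_def distrib_left plus_twpoly.rep_eq mult_twconst_coeff
        twcoeff_mult_tau)
qed

lemma carlitz_coeff_add: "carlitz_coeff (a + b) k = carlitz_coeff a k + carlitz_coeff b k"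
proof -
  have "carlitz (a + b) = carlitz a + carlitz b"
    using carlitz(1) unfolding Fq_algebra_hom_def by blast
  then show ?thesis by (simp add: carlitz_coeff_def plus_twpoly.rep_eq)
qed

lemma carlitz_coeff_const: "carlitz_coeff [:c:] k = (if k = 0 then [:c:] else 0)"
  by (simp add: carlitz_coeff_def carlitz_pCons[of c 0] carlitz_0 twcoeff_twconst)

text \<open>
  The \<open>\<tau>\<^sup>k\<close>-coefficient of the Taylor expansion \<open>C\<^sub>a = \<Sum>\<^sub>j \<partial>\<^sup>j(a) (R - L)\<^sup>j 1\<close>.  Passing from \<open>p\<close>
  to \<open>\<theta>p\<close> multiplies both sides by \<open>R = L + (R - L)\<close>: the Leibniz rule splits the right-hand side
  into these two summands, which recombine because \<open>\<theta> + [k] = \<theta>\<^bsup>q^k\<^esup>\<close>.  Leaving the truncation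
  point \<open>N\<close> free lets the induction run over it.
\<close>

lemma carlitz_coeff_taylor:
  fixes a :: "'a :: finite_field poly"
  assumes "\<And>n. n \<ge> N \<Longrightarrow> coeff a n = 0"
  shows "carlitz_coeff a k = (\<Sum>j<N. hyperderiv j a * difference_coeff k j)"
  using assms
proof (induction N arbitrary: a k)
  case 0
  then have "a = 0" by (simp add: poly_eq_iff)
  then show ?case by (simp add: carlitz_coeff_def carlitz_0 zero_twpoly.rep_eq)
next
  case (Suc N)
  obtain c p where a: "a = pCons c p" by (cases a)
  then have split: "a = [:c:] + theta * p" by simp
  have p: "coeff p n = 0" if "n \<ge> N" for n
    using Suc.prems[of "Suc n"] that a by simp
  let ?S = "\<lambda>k. \<Sum>j<N. hyperderiv j p * difference_coeff k j"
  have "hyperderiv N p = 0" by (rule hyperderiv_eq_0) (rule p)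
  then have S: "?S k = p * difference_coeff k 0 +
      (\<Sum>j<N. hyperderiv (Suc j) p * difference_coeff k (Suc j))"
    using sum.lessThan_Suc_shift[of "\<lambda>j. hyperderiv j p * difference_coeff k j" N]
    by (simp add: hyperderiv_0)
  have "(\<Sum>j<Suc N. hyperderiv j a * difference_coeff k j) =
      a * difference_coeff k 0 +
      (\<Sum>j<N. (theta * hyperderiv (Suc j) p + hyperderiv j p) * difference_coeff k (Suc j))"
    unfolding sum.lessThan_Suc_shift split hyperderiv_0 hyperderiv_linear hyperderiv_Suc_const
      hyperderiv_Suc_theta_mult by (simp only: add_0)
  also have "\<dots> = [:c:] * difference_coeff k 0 + theta * ?S k +
      (\<Sum>j<N. hyperderiv j p * difference_coeff k (Suc j))"
    unfolding S split by (simp only: algebra_simps sum.distrib sum_distrib_left)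
  also have "(\<Sum>j<N. hyperderiv j p * difference_coeff k (Suc j)) =
      carlitz_bracket k * ?S k + (if k = 0 then 0 else ?S (k - 1))"
    unfolding difference_coeff_Suc
    by (auto simp: distrib_left sum.distrib sum_distrib_left mult.left_commute)
  also have "[:c:] * difference_coeff k 0 + theta * ?S k +
      (carlitz_bracket k * ?S k + (if k = 0 then 0 else ?S (k - 1))) =
      carlitz_coeff [:c:] k + (?S k * theta ^ (CARD('a) ^ k) + (if k = 0 then 0 else ?S (k - 1)))"
    unfolding carlitz_bracket_def difference_coeff_0 carlitz_coeff_const
    by (simp only: algebra_simps) simp
  also have "\<dots> = carlitz_coeff a k"
    unfolding split carlitz_coeff_add carlitz_coeff_theta_mult using Suc.IH[OF p] by simp
  finally show ?case by simp
qed

theorem proposition3p6: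
  fixes a :: "'a :: finite_field poly" and d k :: nat
  assumes "a \<noteq> 0" and "degree a = d" and "k \<le> d"
  shows "carlitz_coeff a k =
    (\<Sum>j=k..d. hyperderiv j a * complete_homogeneous k (j - k) carlitz_bracket)"
proof -
  have "carlitz_coeff a k = (\<Sum>j<Suc d. hyperderiv j a * difference_coeff k j)"
    by (rule carlitz_coeff_taylor) (use assms(2) in \<open>simp add: coeff_eq_0\<close>)
  also have "\<dots> = (\<Sum>j=k..d. hyperderiv j a * difference_coeff k j)"
    by (rule sum.mono_neutral_right) (auto simp: difference_coeff_def)
  also have "\<dots> = (\<Sum>j=k..d. hyperderiv j a * complete_homogeneous k (j - k) carlitz_bracket)"
    by (rule sum.cong) (auto simp: difference_coeff_def)
  finally show ?thesis .
qed

end
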